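(* Assume that the noise $\xi_n=y_nx_n-\mathbb E[y_nx_n]$ has $\mathbb E\|\xi_n\|^2<\infty$ and satisfies $\mathbb E[\xi_n\otimes\xi_n]\preccurlyeq\tau^2\Sigma$ for some $\tau\in\mathbb R$. Let $\lambda\ge0$, let $\gamma>0$ be a constant step-size with $\gamma(\Sigma+\lambda I)\preccurlyeq I$, and let $\delta\in\Big[\frac{1-\sqrt{\gamma\lambda}}{1+\sqrt{\gamma\lambda}},1\Big]$. Let $\theta_0\in\mathcal H$, $\theta_{-1}=\theta_0$, and for $n\ge1$ $$\theta_n=\big[I-\gamma\Sigma-\gamma\lambda I\big]\big[\theta_{n-1}+\delta(\theta_{n-1}-\theta_{n-2})\big]+\gamma\,y_nx_n+\gamma\lambda\,\theta_0,\qquad \bar\theta_n=\frac1{n+1}\sum_{i=0}^n\theta_i .$$ Then for every $n\ge1$ $$\mathbb E f(\bar\theta_n)-f(\theta_* )\le 2\Big(\lambda+\frac{36}{\gamma(n+1)^2}\Big)\big\|\Sigma^{1/2}(\Sigma+\lambda I)^{-1/2}(\theta_0-\theta_* )\big\|^2+8\tau^2\,\frac{\operatorname{tr}\big[\Sigma^2(\Sigma+\lambda I)^{-2}\big]}{n+1}.$$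
   Context: $\mathcal H$ is a Euclidean space of dimension $d\ge1$. The observations $(x_n,y_n)\in\mathcal H\times\mathbb R$, $n\ge1$, are i.i.d. with $\mathbb E\|x_n\|^2$ and $\mathbb E y_n^2$ finite. The objective is $f(\theta)=\frac12\mathbb E(\langle x_n,\theta\rangle-y_n)^2$. $\Sigma=\mathbb E[x_n\otimes x_n]$ is the covariance matrix, assumed invertible, and $\theta_*=\Sigma^{-1}\mathbb E[y_nx_n]$ is the global minimizer of $f$. $A\preccurlyeq B$ means that $B-A$ is positive semi-definite. The recursion is accelerated (momentum) stochastic gradient descent on $f+\frac\lambda2\|\cdot-\theta_0\|^2$ with the additive-noise gradient oracle $f_n'(\theta)=\Sigma\theta-y_nx_n=f'(\theta)-\xi_n$. $\theta_0$ is deterministic. *)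

theory Defs
  imports "HOL-Probability.Probability"
begin

text \<open>
  Operators on the Euclidean space are elements of \<open>'a \<Rightarrow>\<^sub>L 'a\<close>. The Bochner integral needs a
  second countable range, which the library does not provide for this type.
\<close>

instance blinfun :: (euclidean_space, euclidean_space) second_countable_topology
proof
  have "\<exists>K. finite K \<and> cball (0::'a \<Rightarrow>\<^sub>L 'b) (real n) \<subseteq> (\<Union>k\<in>K. ball k (1 / Suc m))"
    for n m :: nat
    using seq_compact_imp_totally_bounded[OF compact_imp_seq_compact[OF
      compact_cball[of "0::'a \<Rightarrow>\<^sub>L 'b" "real n"]]]
    by (metis of_nat_0_less_iff zero_less_Suc zero_less_divide_1_iff)
  then obtain K :: "nat \<Rightarrow> nat \<Rightarrow> ('a \<Rightarrow>\<^sub>L 'b) set" where fin: "\<And>n m. finite (K n m)"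
    and cov: "\<And>n m. cball 0 (real n) \<subseteq> (\<Union>k\<in>K n m. ball k (1 / Suc m))"
    by metis
  define B where "B = (\<Union>n. \<Union>m. (\<lambda>k. ball k (1 / Suc m)) ` K n m)"
  have "topological_basis B"
  proof (rule topological_basisI)
    show "open b" if "b \<in> B" for b
      using that by (auto simp: B_def)
    fix A and x :: "'a \<Rightarrow>\<^sub>L 'b"
    assume "open A" "x \<in> A"
    then obtain e where e: "e > 0" "ball x e \<subseteq> A"
      by (meson openE)
    obtain m where m: "1 / Suc m < e / 2"
      using e(1) nat_approx_posE[of "e / 2"] by auto
    obtain n :: nat where n: "norm x \<le> n"
      using real_arch_simple by blast
    obtain k where k: "k \<in> K n m" "x \<in> ball k (1 / Suc m)"
      using cov[of n m] n by fastforce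
    have "ball k (1 / Suc m) \<subseteq> ball x e"
    proof
      fix z assume "z \<in> ball k (1 / Suc m)"
      then show "z \<in> ball x e"
        using k(2) m dist_triangle3[of x z k] by simp
    qed
    moreover have "ball k (1 / Suc m) \<in> B"
      using k(1) unfolding B_def by blast
    ultimately show "\<exists>b\<in>B. x \<in> b \<and> b \<subseteq> A"
      using k(2) e(2) by blast
  qed
  moreover have "countable B"
    unfolding B_def by (intro countable_UN countable_image countableI_type)
      (simp add: countable_finite fin)
  ultimately show "\<exists>B::('a \<Rightarrow>\<^sub>L 'b) set set. countable B \<and> open = generate_topology B"
    using topological_basis_imp_subbasis by auto
qed

definition outer :: "'a::euclidean_space \<Rightarrow> 'a \<Rightarrow> 'a \<Rightarrow>\<^sub>L 'a" where
  "outer u v = blinfun_scaleR_left u o\<^sub>L blinfun_inner_right v"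

lemma outer_apply: "outer u v w = (v \<bullet> w) *\<^sub>R u"
  by (simp add: outer_def)

definition second_moment :: "'w measure \<Rightarrow> ('w \<Rightarrow> 'a::euclidean_space) \<Rightarrow> 'a \<Rightarrow>\<^sub>L 'a" where
  "second_moment M X = (\<integral>\<omega>. outer (X \<omega>) (X \<omega>) \<partial>M)"

definition pos_semidef :: "('a::euclidean_space \<Rightarrow>\<^sub>L 'a) \<Rightarrow> bool" where
  "pos_semidef A \<longleftrightarrow> (\<forall>u v. A u \<bullet> v = u \<bullet> A v) \<and> (\<forall>v. 0 \<le> A v \<bullet> v)"

definition loewner_le :: "('a::euclidean_space \<Rightarrow>\<^sub>L 'a) \<Rightarrow> ('a \<Rightarrow>\<^sub>L 'a) \<Rightarrow> bool"
    (infix \<open>\<preceq>\<^sub>L\<close> 50) where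
  "A \<preceq>\<^sub>L B \<longleftrightarrow> pos_semidef (B - A)"

definition op_invertible :: "('a::euclidean_space \<Rightarrow>\<^sub>L 'a) \<Rightarrow> bool" where
  "op_invertible A \<longleftrightarrow> (\<exists>B. A o\<^sub>L B = id_blinfun \<and> B o\<^sub>L A = id_blinfun)"

text \<open>Unspecified unless \<open>op_invertible A\<close>.\<close>

definition op_inv :: "('a::euclidean_space \<Rightarrow>\<^sub>L 'a) \<Rightarrow> 'a \<Rightarrow>\<^sub>L 'a" where
  "op_inv A = (THE B. A o\<^sub>L B = id_blinfun \<and> B o\<^sub>L A = id_blinfun)"

text \<open>
  The unique positive semi-definite square root; unspecified unless \<open>pos_semidef A\<close>.
\<close>

definition op_sqrt :: "('a::euclidean_space \<Rightarrow>\<^sub>L 'a) \<Rightarrow> 'a \<Rightarrow>\<^sub>L 'a" where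
  "op_sqrt A = (THE B. pos_semidef B \<and> B o\<^sub>L B = A)"

definition op_trace :: "('a::euclidean_space \<Rightarrow>\<^sub>L 'a) \<Rightarrow> real" where
  "op_trace A = (\<Sum>b\<in>Basis. A b \<bullet> b)"

definition objective ::
    "'w measure \<Rightarrow> ('w \<Rightarrow> 'a::euclidean_space) \<Rightarrow> ('w \<Rightarrow> real) \<Rightarrow> 'a \<Rightarrow> real" where
  "objective M X Y \<theta> = (\<integral>\<omega>. (X \<omega> \<bullet> \<theta> - Y \<omega>)\<^sup>2 \<partial>M) / 2"

text \<open>
  The indices start at 1; the values of \<open>x 0\<close> and \<open>y 0\<close> are irrelevant.
\<close>

definition iid_observations ::
    "'w measure \<Rightarrow> (nat \<Rightarrow> 'w \<Rightarrow> 'a::euclidean_space) \<Rightarrow> (nat \<Rightarrow> 'w \<Rightarrow> real) \<Rightarrow> bool" where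
  "iid_observations M x y \<longleftrightarrow>
     prob_space.indep_vars M (\<lambda>_. borel) (\<lambda>n \<omega>. (x n \<omega>, y n \<omega>)) {1..} \<and>
     (\<forall>n\<ge>1. distr M borel (\<lambda>\<omega>. (x n \<omega>, y n \<omega>)) = distr M borel (\<lambda>\<omega>. (x 1 \<omega>, y 1 \<omega>)))"

definition gradient_noise ::
    "'w measure \<Rightarrow> ('w \<Rightarrow> 'a::euclidean_space) \<Rightarrow> ('w \<Rightarrow> real) \<Rightarrow> 'w \<Rightarrow> 'a" where
  "gradient_noise M X Y \<omega> = Y \<omega> *\<^sub>R X \<omega> - (\<integral>\<omega>'. Y \<omega>' *\<^sub>R X \<omega>' \<partial>M)"

end

theory Submission
  imports Defs
begin

text \<open>
  In an orthonormal eigenbasis of \<open>\<Sigma>\<close> the recursion decouples into scalar ones. For an eigenvalue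
  \<open>s\<close> put \<open>a = \<gamma> (s + lam)\<close>. The averaged error is an affine function of the noise, and all its
  coefficients are expressed by one sequence \<open>w\<close>, the homogeneous recursion started at \<open>1\<close>. The energy
  \<open>a w\<^sub>k\<^sup>2 + (w\<^sub>k - w\<^sub>k\<^sub>-\<^sub>1)\<^sup>2\<close> does not increase, so \<open>\<bar>w\<^sub>k\<bar> \<le> 1\<close> (which bounds the coefficients of the
  noise) and \<open>\<bar>w\<^sub>k - w\<^sub>k\<^sub>-\<^sub>1\<bar> \<le> sqrt a\<close>. Summing the recursion expresses \<open>a (w\<^sub>0 + \<dots> + w\<^sub>n)\<close> by the last
  two terms, and the lower bound on \<open>\<delta>\<close> makes \<open>\<bar>w\<^sub>0 + \<dots> + w\<^sub>n\<bar> \<le> 6 / sqrt a\<close>, which bounds the bias.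
\<close>

section \<open>The scalar momentum recursion\<close>

lemma real_sum_square_le: "(u + v)\<^sup>2 \<le> 2 * u\<^sup>2 + 2 * v\<^sup>2" for u v :: real
  using zero_le_power2[of "u - v"] by (simp add: power2_eq_square algebra_simps)

text \<open>Split the step at the extrapolated point \<open>y = p + d * (p - q)\<close>. Contracting
  \<open>y\<close> to \<open>w\<close> lowers the energy by an explicit nonnegative amount, and
  extrapolating multiplies the squared velocity by \<open>d\<^sup>2\<close>, which is at most
  \<open>1\<close>.\<close>

lemma momentum_energy_step:
  fixes a d p q w :: real
  assumes a: "0 \<le> a" "a \<le> 1" and d: "0 \<le> d" "d \<le> 1"
    and w: "w = (1 - a) * (p + d * (p - q))"
  shows "a * w\<^sup>2 + (w - p)\<^sup>2 \<le> a * p\<^sup>2 + (p - q)\<^sup>2"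
proof -
  define y where "y = p + d * (p - q)"
  have dv: "d * (p - q) = y - p" by (simp add: y_def)
  have "a * p\<^sup>2 + (y - p)\<^sup>2 - (a * w\<^sup>2 + (w - p)\<^sup>2) =
      a * ((y - p)\<^sup>2 + a * (1 - a) * y\<^sup>2)"
    unfolding w y_def[symmetric] by (simp add: power2_eq_square algebra_simps)
  also have "\<dots> \<ge> 0" using a by simp
  finally have 1: "a * w\<^sup>2 + (w - p)\<^sup>2 \<le> a * p\<^sup>2 + (y - p)\<^sup>2" by simp
  have "(y - p)\<^sup>2 = d\<^sup>2 * (p - q)\<^sup>2" by (simp add: dv[symmetric] power_mult_distrib)
  also have "\<dots> \<le> 1 * (p - q)\<^sup>2"
    using d by (intro mult_right_mono) (auto simp: power_le_one)
  finally show ?thesis using 1 by simp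
qed

text \<open>The homogeneous recursion started at \<open>w\<^sub>-\<^sub>1 = w\<^sub>0 = 1\<close>; the value at index \<open>-1\<close> is not represented.\<close>

fun momentum :: "real \<Rightarrow> real \<Rightarrow> nat \<Rightarrow> real" where
  "momentum a d 0 = 1"
| "momentum a d (Suc 0) = 1 - a"
| "momentum a d (Suc (Suc k)) =
    (1 - a) * (momentum a d (Suc k) + d * (momentum a d (Suc k) - momentum a d k))"

text \<open>The bound \<open>a\<close> is the initial energy: the fictitious value at index -1
  equals the value \<open>1\<close> at index 0, so the velocity starts at zero.\<close>

lemma momentum_energy:
  assumes "0 \<le> a" "a \<le> 1" "0 \<le> d" "d \<le> 1"
  shows "a * (momentum a d (Suc k))\<^sup>2 + (momentum a d (Suc k) - momentum a d k)\<^sup>2 \<le> a"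
proof (induction k)
  case 0
  show ?case
    using momentum_energy_step[OF assms, of "1 - a" 1 1] by simp
next
  case (Suc k)
  then show ?case
    using momentum_energy_step[OF assms, of "momentum a d (Suc (Suc k))" "momentum a d (Suc k)" "momentum a d k"]
    by simp
qed

lemma abs_momentum_le:
  assumes "0 < a" "a \<le> 1" "0 \<le> d" "d \<le> 1"
  shows "\<bar>momentum a d k\<bar> \<le> 1"
proof (cases k)
  case (Suc m)
  have "a * (momentum a d k)\<^sup>2 + (momentum a d k - momentum a d m)\<^sup>2 \<le> a"
    using momentum_energy[of a d m] assms Suc by simp
  then have "a * (momentum a d k)\<^sup>2 \<le> a * 1"
    using zero_le_power2[of "momentum a d k - momentum a d m"] by linarith
  then show ?thesis
    using assms by (simp add: abs_square_le_1)
qed simp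

lemma abs_momentum_diff_le:
  assumes "0 \<le> a" "a \<le> 1" "0 \<le> d" "d \<le> 1"
  shows "\<bar>momentum a d (Suc k) - momentum a d k\<bar> \<le> sqrt a"
proof (rule real_le_rsqrt)
  show "\<bar>momentum a d (Suc k) - momentum a d k\<bar>\<^sup>2 \<le> a"
    using momentum_energy[OF assms, of k] assms(1)
      mult_nonneg_nonneg[of a "(momentum a d (Suc k))\<^sup>2"]
    unfolding power2_abs by (meson add_le_cancel_right le_add_same_cancel2 order.trans zero_le_power2)
qed

text \<open>Summing the recursion telescopes the velocity terms. The right-hand side is arranged so
  that, apart from \<open>a\<close>, each term carries a small factor: \<open>1 - d\<close> or the
  last velocity.\<close>

lemma momentum_sum:
  "a * (\<Sum>k\<le>Suc n. momentum a d k) = a + (1 - a) * (1 - d) * (1 - momentum a d (Suc n))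
     - (1 - a) * d * (momentum a d (Suc n) - momentum a d n)"
proof (induction n)
  case 0
  show ?case by (simp add: algebra_simps)
next
  case (Suc n)
  then show ?case by (simp add: algebra_simps)
qed

text \<open>All three terms of \<open>momentum_sum\<close> are of order \<open>sqrt a\<close>:
  \<open>a \<le> sqrt a\<close>, the energy controls the velocity, and the lower bound on
  \<open>d\<close> gives \<open>1 - d \<le> 2 * sqrt l\<close>. Dividing by \<open>a\<close> leaves
  the order \<open>1 / sqrt a\<close>. In the application \<open>l = \<gamma> * lam\<close>.\<close>

lemma abs_momentum_sum_le:
  assumes a: "0 < a" "a \<le> 1" and l: "0 \<le> l" "l \<le> a"
    and d: "(1 - sqrt l) / (1 + sqrt l) \<le> d" "d \<le> 1"
  shows "\<bar>\<Sum>k\<le>Suc n. momentum a d k\<bar> \<le> 6 / sqrt a"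
proof -
  define w where "w = momentum a d"
  define T where "T = (\<Sum>k\<le>Suc n. w k)"
  have l1: "l \<le> 1" and sl: "0 \<le> sqrt l" "sqrt l \<le> 1" using a l by auto
  then have "0 \<le> (1 - sqrt l) / (1 + sqrt l)" by simp
  then have d0: "0 \<le> d" using d by simp
  have "1 - sqrt l \<le> d * (1 + sqrt l)"
    using d sl by (simp add: divide_le_eq)
  also have "\<dots> \<le> d + sqrt l" using d sl mult_right_mono[of d 1 "sqrt l"] by (simp add: algebra_simps)
  finally have "1 - d \<le> 2 * sqrt l" by simp
  moreover have "sqrt l \<le> sqrt a" using l by simp
  ultimately have d1: "1 - d \<le> 2 * sqrt a" by linarith
  have w1: "\<bar>1 - w (Suc n)\<bar> \<le> 2"
    using abs_momentum_le[OF a d0 d(2), of "Suc n"] by (auto simp: w_def)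
  have "\<bar>(1 - a) * (1 - d) * (1 - w (Suc n))\<bar> \<le> 1 * (2 * sqrt a) * 2"
    unfolding abs_mult using a d d1 w1 by (intro mult_mono) auto
  moreover have "\<bar>(1 - a) * d * (w (Suc n) - w n)\<bar> \<le> 1 * 1 * sqrt a"
    unfolding abs_mult using a d d0 abs_momentum_diff_le[of a d n]
    by (intro mult_mono) (auto simp: w_def)
  moreover have sa: "a \<le> sqrt a"
    using a mult_right_mono[of "sqrt a" 1 "sqrt a"] by simp
  \<comment> \<open>The three terms contribute \<open>1\<close>, \<open>4\<close> and
    \<open>1\<close> times \<open>sqrt a\<close>.\<close>
  ultimately have "\<bar>a * T\<bar> \<le> 6 * sqrt a"
    unfolding T_def w_def momentum_sum using a unfolding w_def by linarith
  moreover have "a = sqrt a * sqrt a" using a by simp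
  ultimately have "sqrt a * (\<bar>T\<bar> * sqrt a) \<le> sqrt a * 6"
    using a by (metis abs_mult abs_of_pos mult.assoc mult.commute)
  then show ?thesis
    using a by (simp add: T_def w_def pos_le_divide_eq)
qed

text \<open>In units of \<open>u 0\<close>, the constant forcing has the fixed point
  \<open>c / a\<close>, and the deviation from it evolves like \<open>w\<close>. By linearity the
  rest starts at zero and is driven by \<open>e\<close> alone, so its partial sums are a convolution
  with \<open>e\<close>.\<close>

lemma momentum_recursion_sum:
  fixes u e :: "nat \<Rightarrow> real"
  assumes a: "a \<noteq> 0"
    and u1: "u (Suc 0) = (1 - a) * u 0 + e (Suc 0) + c * u 0"
    and step: "\<And>k. u (Suc (Suc k)) =
      (1 - a) * (u (Suc k) + d * (u (Suc k) - u k)) + e (Suc (Suc k)) + c * u 0"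
  shows "(\<Sum>k\<le>n. u k) =
    u 0 * (real (Suc n) * (c / a) + (1 - c / a) * (\<Sum>k\<le>n. momentum a d k)) +
    (\<Sum>j=1..n. (1 - momentum a d (Suc n - j)) * e j) / a"
proof -
  define w where "w = momentum a d"
  define v where "v k = c / a + (1 - c / a) * w k" for k
  define z where "z k = u k - u 0 * v k" for k
  text \<open>\<open>u 0 * v k\<close> is the noiseless solution, and \<open>(1 - w k) / a\<close> is the summed impulse response.\<close>
  define G where "G n = (\<Sum>j=1..n. (1 - w (Suc n - j)) * e j)" for n
  have z0: "z 0 = 0" by (simp add: z_def v_def w_def)
  have z1: "z (Suc 0) = e (Suc 0)" using a
    by (simp add: z_def v_def w_def u1 field_simps)
  have z2: "z (Suc (Suc k)) = (1 - a) * (z (Suc k) + d * (z (Suc k) - z k)) + e (Suc (Suc k))" for k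
  proof -
    have "v (Suc (Suc k)) = (1 - a) * (v (Suc k) + d * (v (Suc k) - v k)) + c"
      using a by (simp add: v_def w_def field_simps)
    then show ?thesis unfolding z_def step by algebra
  qed
  \<comment> \<open>The velocities telescope to \<open>z n\<close> because
    \<open>z 0 = 0\<close>.\<close>
  have zsum: "(\<Sum>k\<le>Suc n. z k) = (1 - a) * ((\<Sum>k\<le>n. z k) + d * z n) + (\<Sum>j=1..Suc n. e j)" for n
    by (induction n) (simp_all add: z0 z1 z2 algebra_simps)
  \<comment> \<open>Two consecutive partial sums are carried through the induction: their difference
    recovers \<open>z (Suc n)\<close>, which \<open>zsum\<close> needs for the next one.\<close>
  have Gz: "(\<Sum>k\<le>n. z k) = G n / a \<and> (\<Sum>k\<le>Suc n. z k) = G (Suc n) / a" for n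
  proof (induction n)
    case 0
    show ?case using a by (simp add: z0 z1 G_def w_def)
  next
    case (Suc n)
    have zS: "z (Suc n) = (G (Suc n) - G n) / a"
      using Suc by (simp add: diff_divide_distrib)
    \<comment> \<open>\<open>{1..n}\<close> is the index range shared by the three convolution sums.
      On it the coefficients \<open>1 - w\<close> obey the recursion of \<open>w\<close> with an
      added constant \<open>a\<close>, which produces the summed noise; \<open>S\<close> then
      restores the boundary indices.\<close>
    have inner: "(\<Sum>j=1..n. (1 - w (Suc (Suc (Suc n)) - j)) * e j) =
        (1 - a) * ((\<Sum>j=1..n. (1 - w (Suc (Suc n) - j)) * e j)
          + d * ((\<Sum>j=1..n. (1 - w (Suc (Suc n) - j)) * e j) - (\<Sum>j=1..n. (1 - w (Suc n - j)) * e j)))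
          + a * (\<Sum>j=1..n. e j)"
    proof -
      have "(1 - w (Suc (Suc (Suc n)) - j)) * e j =
          (1 - a) * ((1 - w (Suc (Suc n) - j)) * e j + d * ((1 - w (Suc (Suc n) - j)) * e j
             - (1 - w (Suc n - j)) * e j)) + a * e j" if "j \<in> {1..n}" for j
      proof -
        have "Suc (Suc (Suc n)) - j = Suc (Suc (Suc n - j))" "Suc (Suc n) - j = Suc (Suc n - j)"
          using that by auto
        then show ?thesis by (simp add: w_def algebra_simps)
      qed
      then show ?thesis
        by (simp add: sum.distrib sum_subtractf flip: sum_distrib_left)
    qed
    have S: "G (Suc (Suc n)) = (\<Sum>j=1..n. (1 - w (Suc (Suc (Suc n)) - j)) * e j)
        + (1 - w 2) * e (Suc n) + (1 - w 1) * e (Suc (Suc n))"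
      "G (Suc n) = (\<Sum>j=1..n. (1 - w (Suc (Suc n) - j)) * e j) + (1 - w 1) * e (Suc n)"
      by (simp_all add: G_def Suc_diff_le numeral_2_eq_2)
    have w12: "w 1 = 1 - a" "w 2 = (1 - a) * (1 - a + d * (1 - a - 1))"
      by (simp_all add: w_def numeral_2_eq_2)
    have "G (Suc (Suc n)) = (1 - a) * (G (Suc n) + d * (G (Suc n) - G n)) + a * (\<Sum>j=1..Suc (Suc n). e j)"
      unfolding S inner w12 G_def[of n] by (simp add: algebra_simps)
    then show ?case
      using Suc zsum[of "Suc n"] zS a by (simp add: field_simps)
  qed
  have "(\<Sum>k\<le>n. u k) = (\<Sum>k\<le>n. u 0 * v k) + (\<Sum>k\<le>n. z k)"
    by (simp add: z_def sum_subtractf)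
  also have "\<dots> = u 0 * (real (Suc n) * (c / a) + (1 - c / a) * (\<Sum>k\<le>n. w k)) + G n / a"
    using Gz[of n] by (simp add: v_def sum.distrib sum_distrib_left[symmetric])
  finally show ?thesis by (simp add: w_def G_def)
qed

text \<open>With \<open>r = l / a\<close> in \<open>[0, 1]\<close> the averaged factor is
  \<open>r + (1 - r) * T / N\<close>. Then \<open>r\<^sup>2 \<le> r\<close> handles the first part,
  the bound \<open>6 / sqrt a\<close> on the sum gives \<open>36 / a\<close> in the second, and
  splitting the square costs the factor \<open>2\<close>.\<close>

lemma averaged_bias_le:
  assumes a: "0 < a" "a \<le> 1" and l: "0 \<le> l" "l \<le> a"
    and d: "(1 - sqrt l) / (1 + sqrt l) \<le> d" "d \<le> 1" and N: "N = real (Suc (Suc n))"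
  shows "((N * (l / a) + (1 - l / a) * (\<Sum>k\<le>Suc n. momentum a d k)) / N)\<^sup>2 \<le>
     2 * (l + 36 / N\<^sup>2) / a"
proof -
  define T where "T = (\<Sum>k\<le>Suc n. momentum a d k)"
  have N0: "N > 0" using N by simp
  have r: "0 \<le> l / a" "l / a \<le> 1" using a l by auto
  have "\<bar>(1 - l / a) * T\<bar> \<le> 1 * (6 / sqrt a)"
    unfolding abs_mult using r abs_momentum_sum_le[OF a l d, of n] unfolding T_def
    by (intro mult_mono) auto
  then have "((1 - l / a) * T)\<^sup>2 \<le> (6 / sqrt a)\<^sup>2"
    by (metis abs_le_square_iff abs_ge_self mult_1 order.trans)
  also have "\<dots> = 36 / a" using a by (simp add: power_divide)
  finally have T2: "((1 - l / a) * T / N)\<^sup>2 \<le> 36 / a / N\<^sup>2"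
    unfolding power_divide by (intro divide_right_mono) auto
  have "(l / a)\<^sup>2 \<le> l / a"
    unfolding power2_eq_square using r by (rule mult_left_le[rotated])
  moreover have "2 * (l + 36 / N\<^sup>2) / a = 2 * (l / a) + 2 * (36 / a / N\<^sup>2)"
    using a N0 by (simp add: field_simps)
  ultimately have "2 * (l / a)\<^sup>2 + 2 * ((1 - l / a) * T / N)\<^sup>2 \<le> 2 * (l + 36 / N\<^sup>2) / a"
    using T2 by linarith
  moreover have "(N * (l / a) + (1 - l / a) * T) / N = l / a + (1 - l / a) * T / N"
    using N0 by (simp add: field_simps)
  ultimately show ?thesis
    unfolding T_def using real_sum_square_le[of "l / a"] by (auto intro: order_trans)
qed

section \<open>Second moments under independent noise\<close>

context prob_space
begin

text \<open>Independent centered variables are orthogonal in L2, so only the diagonal of the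
  expanded square survives.\<close>

lemma indep_centered_sum_square:
  fixes X :: "'i \<Rightarrow> 'a \<Rightarrow> real"
  assumes indep: "indep_vars (\<lambda>_. borel) X I" and fin: "finite I"
    and sq: "\<And>i. i \<in> I \<Longrightarrow> integrable M (\<lambda>\<omega>. (X i \<omega>)\<^sup>2)"
    and mean: "\<And>i. i \<in> I \<Longrightarrow> expectation (X i) = 0"
  shows "integrable M (\<lambda>\<omega>. (\<Sum>i\<in>I. c i * X i \<omega>)\<^sup>2)"
    and "expectation (\<lambda>\<omega>. (\<Sum>i\<in>I. c i * X i \<omega>)\<^sup>2) = (\<Sum>i\<in>I. (c i)\<^sup>2 * expectation (\<lambda>\<omega>. (X i \<omega>)\<^sup>2))"
proof -
  have [measurable]: "i \<in> I \<Longrightarrow> X i \<in> borel_measurable M" for i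
    using indep by (auto simp: indep_vars_def)
  have int: "i \<in> I \<Longrightarrow> integrable M (X i)" for i
    by (rule square_integrable_imp_integrable[OF _ sq]) measurable
  have cross: "integrable M (\<lambda>\<omega>. X i \<omega> * X j \<omega>) \<and>
      expectation (\<lambda>\<omega>. X i \<omega> * X j \<omega>) = (if i = j then expectation (\<lambda>\<omega>. (X i \<omega>)\<^sup>2) else 0)"
    if ij: "i \<in> I" "j \<in> I" for i j
  proof (cases "i = j")
    case True
    then show ?thesis using sq[OF ij(1)] by (simp add: power2_eq_square)
  next
    case False
    have "indep_vars (\<lambda>_. borel) X {i, j}"
      using ij by (intro indep_vars_subset[OF indep]) auto
    moreover have "\<And>k. k \<in> {i, j} \<Longrightarrow> integrable M (X k)"
      using ij int by auto
    ultimately have "integrable M (\<lambda>\<omega>. \<Prod>k\<in>{i, j}. X k \<omega>)"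
        "expectation (\<lambda>\<omega>. \<Prod>k\<in>{i, j}. X k \<omega>) = (\<Prod>k\<in>{i, j}. expectation (X k))"
      using indep_vars_integrable[of "{i, j}" X] indep_vars_lebesgue_integral[of "{i, j}" X] by simp_all
    then show ?thesis using False mean[OF ij(1)] by simp
  qed
  have expand: "(\<Sum>i\<in>I. c i * X i \<omega>)\<^sup>2 = (\<Sum>i\<in>I. \<Sum>j\<in>I. c i * c j * (X i \<omega> * X j \<omega>))" for \<omega>
    unfolding power2_eq_square sum_product by (intro sum.cong refl) (simp only: mult_ac)
  show "integrable M (\<lambda>\<omega>. (\<Sum>i\<in>I. c i * X i \<omega>)\<^sup>2)"
    unfolding expand
    by (intro Bochner_Integration.integrable_sum integrable_mult_right conjunct1[OF cross])
  have "expectation (\<lambda>\<omega>. (\<Sum>i\<in>I. c i * X i \<omega>)\<^sup>2) =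
      (\<Sum>i\<in>I. expectation (\<lambda>\<omega>. \<Sum>j\<in>I. c i * c j * (X i \<omega> * X j \<omega>)))"
    unfolding expand
    by (intro Bochner_Integration.integral_sum Bochner_Integration.integrable_sum
        integrable_mult_right conjunct1[OF cross])
  also have "\<dots> = (\<Sum>i\<in>I. \<Sum>j\<in>I. expectation (\<lambda>\<omega>. c i * c j * (X i \<omega> * X j \<omega>)))"
    by (intro sum.cong refl Bochner_Integration.integral_sum integrable_mult_right conjunct1[OF cross])
  also have "\<dots> = (\<Sum>i\<in>I. \<Sum>j\<in>I. if i = j then (c i)\<^sup>2 * expectation (\<lambda>\<omega>. (X i \<omega>)\<^sup>2) else 0)"
    by (intro sum.cong refl) (simp add: cross power2_eq_square[of "c _"])
  also have "\<dots> = (\<Sum>i\<in>I. (c i)\<^sup>2 * expectation (\<lambda>\<omega>. (X i \<omega>)\<^sup>2))"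
    using fin by simp
  finally show "expectation (\<lambda>\<omega>. (\<Sum>i\<in>I. c i * X i \<omega>)\<^sup>2) = \<dots>" .
qed

text \<open>Bias and noise are separated by \<open>real_sum_square_le\<close>, whence the factor
  \<open>2\<close> in front of both parts; the noise part is a sum of variances.\<close>

lemma affine_noise_second_moment_le:
  fixes X :: "'i \<Rightarrow> 'a \<Rightarrow> real" and \<beta> v C :: real
  assumes indep: "indep_vars (\<lambda>_. borel) X I" and fin: "finite I"
    and sq: "\<And>i. i \<in> I \<Longrightarrow> integrable M (\<lambda>\<omega>. (X i \<omega>)\<^sup>2)"
    and mean: "\<And>i. i \<in> I \<Longrightarrow> expectation (X i) = 0"
    and var: "\<And>i. i \<in> I \<Longrightarrow> expectation (\<lambda>\<omega>. (X i \<omega>)\<^sup>2) \<le> v"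
    and c: "\<And>i. i \<in> I \<Longrightarrow> \<bar>c i\<bar> \<le> C"
  shows "integrable M (\<lambda>\<omega>. (\<beta> + (\<Sum>i\<in>I. c i * X i \<omega>))\<^sup>2)"
    and "expectation (\<lambda>\<omega>. (\<beta> + (\<Sum>i\<in>I. c i * X i \<omega>))\<^sup>2) \<le> 2 * \<beta>\<^sup>2 + 2 * (card I * (C\<^sup>2 * v))"
proof -
  have [measurable]: "i \<in> I \<Longrightarrow> X i \<in> borel_measurable M" for i
    using indep by (auto simp: indep_vars_def)
  note S = indep_centered_sum_square[OF indep fin sq mean, of c, simplified]
  have le: "(\<beta> + (\<Sum>i\<in>I. c i * X i \<omega>))\<^sup>2 \<le> 2 * \<beta>\<^sup>2 + 2 * (\<Sum>i\<in>I. c i * X i \<omega>)\<^sup>2" for \<omega>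
    by (rule real_sum_square_le)
  have int: "integrable M (\<lambda>\<omega>. 2 * \<beta>\<^sup>2 + 2 * (\<Sum>i\<in>I. c i * X i \<omega>)\<^sup>2)"
    using S(1) by simp
  show I: "integrable M (\<lambda>\<omega>. (\<beta> + (\<Sum>i\<in>I. c i * X i \<omega>))\<^sup>2)"
    by (rule Bochner_Integration.integrable_bound[OF int]) (use le in auto)
  have "expectation (\<lambda>\<omega>. (\<beta> + (\<Sum>i\<in>I. c i * X i \<omega>))\<^sup>2) \<le>
      expectation (\<lambda>\<omega>. 2 * \<beta>\<^sup>2 + 2 * (\<Sum>i\<in>I. c i * X i \<omega>)\<^sup>2)"
    by (intro integral_mono I int le)
  also have "\<dots> = 2 * \<beta>\<^sup>2 + 2 * (\<Sum>i\<in>I. (c i)\<^sup>2 * expectation (\<lambda>\<omega>. (X i \<omega>)\<^sup>2))"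
    using S by (simp add: prob_space)
  also have "(\<Sum>i\<in>I. (c i)\<^sup>2 * expectation (\<lambda>\<omega>. (X i \<omega>)\<^sup>2)) \<le> (\<Sum>i\<in>I. C\<^sup>2 * v)"
    using c var by (intro sum_mono mult_mono) (auto simp flip: abs_le_square_iff intro: order_trans[OF _ abs_ge_self])
  finally show "expectation (\<lambda>\<omega>. (\<beta> + (\<Sum>i\<in>I. c i * X i \<omega>))\<^sup>2) \<le> 2 * \<beta>\<^sup>2 + 2 * (card I * (C\<^sup>2 * v))"
    by simp
qed

text \<open>This is the estimate in one eigendirection, with eigenvalue \<open>s\<close> and error
  coordinate \<open>u\<close>. The average is \<open>U\<close> times a bias factor plus a linear
  form in the noise, and the two parts are bounded separately.\<close>

lemma averaged_momentum_second_moment_le: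
  fixes X u :: "nat \<Rightarrow> 'a \<Rightarrow> real"
  assumes s: "0 < s" and lam: "0 \<le> lam" and \<gamma>: "0 < \<gamma>" "\<gamma> * (s + lam) \<le> 1"
    and \<delta>: "(1 - sqrt (\<gamma> * lam)) / (1 + sqrt (\<gamma> * lam)) \<le> \<delta>" "\<delta> \<le> 1"
    and n: "1 \<le> n"
    and indep: "indep_vars (\<lambda>_. borel) X {1..n}"
    and sq: "\<And>i. i \<in> {1..n} \<Longrightarrow> integrable M (\<lambda>\<omega>. (X i \<omega>)\<^sup>2)"
    and mean: "\<And>i. i \<in> {1..n} \<Longrightarrow> expectation (X i) = 0"
    and var: "\<And>i. i \<in> {1..n} \<Longrightarrow> expectation (\<lambda>\<omega>. (X i \<omega>)\<^sup>2) \<le> v"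
    and u0: "\<And>\<omega>. \<omega> \<in> space M \<Longrightarrow> u 0 \<omega> = U"
    and u1: "\<And>\<omega>. \<omega> \<in> space M \<Longrightarrow>
      u (Suc 0) \<omega> = (1 - \<gamma> * (s + lam)) * U + \<gamma> * X (Suc 0) \<omega> + \<gamma> * lam * U"
    and step: "\<And>k \<omega>. \<omega> \<in> space M \<Longrightarrow> u (Suc (Suc k)) \<omega> =
      (1 - \<gamma> * (s + lam)) * (u (Suc k) \<omega> + \<delta> * (u (Suc k) \<omega> - u k \<omega>))
        + \<gamma> * X (Suc (Suc k)) \<omega> + \<gamma> * lam * U"
  defines "N \<equiv> real n + 1" and "A \<equiv> \<lambda>\<omega>. (\<Sum>k\<le>n. u k \<omega>) / (real n + 1)"
  shows "integrable M (\<lambda>\<omega>. (A \<omega>)\<^sup>2)"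
    and "expectation (\<lambda>\<omega>. (A \<omega>)\<^sup>2) \<le>
      4 * (lam + 36 / (\<gamma> * N\<^sup>2)) * U\<^sup>2 / (s + lam) + 8 * v / ((s + lam)\<^sup>2 * N)"
proof -
  define h where "h = s + lam"
  define a where "a = \<gamma> * h"
  define l where "l = \<gamma> * lam"
  have h: "0 < h" using s lam by (simp add: h_def)
  have a: "0 < a" "a \<le> 1" using h \<gamma> by (auto simp: a_def h_def)
  have l: "0 \<le> l" "l \<le> a" using \<gamma> lam s by (auto simp: a_def l_def h_def)
  have N: "0 < N" by (simp add: N_def)
  have d: "(1 - sqrt l) / (1 + sqrt l) \<le> \<delta>" using \<delta> by (simp add: l_def)
  obtain m where m: "n = Suc m" using n by (cases n) auto
  have "sqrt l \<le> 1" using a l by simp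
  then have "0 \<le> (1 - sqrt l) / (1 + sqrt l)" using l by simp
  then have \<delta>0: "0 \<le> \<delta>" using d by simp
  define \<beta> where "\<beta> = (N * (l / a) + (1 - l / a) * (\<Sum>k\<le>n. momentum a \<delta> k)) / N"
  \<comment> \<open>Since \<open>a = \<gamma> * h\<close>, the step-size cancels from the noise
    coefficients.\<close>
  define c where "c j = (1 - momentum a \<delta> (Suc n - j)) / (h * N)" for j
  have A: "A \<omega> = U * \<beta> + (\<Sum>j=1..n. c j * X j \<omega>)" if \<omega>: "\<omega> \<in> space M" for \<omega>
  proof -
    have "(\<Sum>k\<le>n. u k \<omega>) = u 0 \<omega> * (real (Suc n) * (l / a) + (1 - l / a) * (\<Sum>k\<le>n. momentum a \<delta> k))
        + (\<Sum>j=1..n. (1 - momentum a \<delta> (Suc n - j)) * (\<gamma> * X j \<omega>)) / a"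
      using u1[OF \<omega>] step[OF \<omega>] u0[OF \<omega>] a
      by (intro momentum_recursion_sum) (auto simp: a_def h_def l_def)
    also have "real (Suc n) = N" by (simp add: N_def)
    finally have S: "(\<Sum>k\<le>n. u k \<omega>) = U * (N * (l / a) + (1 - l / a) * (\<Sum>k\<le>n. momentum a \<delta> k))
        + (\<Sum>j=1..n. (1 - momentum a \<delta> (Suc n - j)) * (\<gamma> * X j \<omega>)) / a"
      by (simp only: u0[OF \<omega>])
    have "A \<omega> = U * \<beta> + (\<Sum>j=1..n. (1 - momentum a \<delta> (Suc n - j)) * (\<gamma> * X j \<omega>)) / a / N"
      unfolding A_def N_def[symmetric] \<beta>_def S
      by (subst add_divide_distrib) (simp only: times_divide_eq_right)
    also have "(\<Sum>j=1..n. (1 - momentum a \<delta> (Suc n - j)) * (\<gamma> * X j \<omega>)) / a / N = (\<Sum>j=1..n. c j * X j \<omega>)"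
      unfolding sum_divide_distrib c_def a_def using \<gamma> h N by (intro sum.cong) (auto simp: field_simps)
    finally show ?thesis .
  qed
  have c: "\<bar>c j\<bar> \<le> 2 / (h * N)" for j
  proof -
    have "\<bar>1 - momentum a \<delta> (Suc n - j)\<bar> \<le> 2"
      using abs_momentum_le[OF a \<delta>0 \<delta>(2), of "Suc n - j"] by auto
    then show ?thesis using h N by (simp add: c_def abs_mult divide_right_mono)
  qed
  note aff = affine_noise_second_moment_le[OF indep _ sq mean var c, of "U * \<beta>", simplified]
  \<comment> \<open>This sign allows the count \<open>n\<close> of noise terms to be enlarged to
    \<open>N\<close>, which cancels one power of \<open>N\<close> in the variance.\<close>
  have v: "0 \<le> v"
    using order_trans[OF Bochner_Integration.integral_nonneg var[of 1]] n by simp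
  show "integrable M (\<lambda>\<omega>. (A \<omega>)\<^sup>2)"
    using aff(1) by (subst Bochner_Integration.integrable_cong[OF refl]) (auto simp: A)
  have "expectation (\<lambda>\<omega>. (A \<omega>)\<^sup>2) = expectation (\<lambda>\<omega>. (U * \<beta> + (\<Sum>j=1..n. c j * X j \<omega>))\<^sup>2)"
    by (intro Bochner_Integration.integral_cong) (auto simp: A)
  also have "\<dots> \<le> 2 * (U * \<beta>)\<^sup>2 + 2 * (real n * ((2 / (h * N))\<^sup>2 * v))"
    using aff(2) by simp
  also have "\<dots> \<le> 2 * (U\<^sup>2 * (2 * (l + 36 / N\<^sup>2) / a)) + 2 * (N * ((2 / (h * N))\<^sup>2 * v))"
  proof -
    have "\<beta>\<^sup>2 \<le> 2 * (l + 36 / N\<^sup>2) / a"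
      unfolding \<beta>_def unfolding m
      by (rule averaged_bias_le[OF a l d \<delta>(2)]) (simp add: N_def m)
    then have "(U * \<beta>)\<^sup>2 \<le> U\<^sup>2 * (2 * (l + 36 / N\<^sup>2) / a)"
      unfolding power_mult_distrib by (intro mult_left_mono) auto
    moreover have "real n * ((2 / (h * N))\<^sup>2 * v) \<le> N * ((2 / (h * N))\<^sup>2 * v)"
      using v by (intro mult_right_mono) (auto simp: N_def)
    ultimately show ?thesis by linarith
  qed
  also have "\<dots> = 4 * (lam + 36 / (\<gamma> * N\<^sup>2)) * U\<^sup>2 / h + 8 * v / (h\<^sup>2 * N)"
    using \<gamma> h N by (simp add: a_def l_def field_simps power2_eq_square)
  finally show "expectation (\<lambda>\<omega>. (A \<omega>)\<^sup>2) \<le>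
      4 * (lam + 36 / (\<gamma> * N\<^sup>2)) * U\<^sup>2 / (s + lam) + 8 * v / ((s + lam)\<^sup>2 * N)"
    by (simp add: h_def)
qed

end

section \<open>Operators diagonal in an orthonormal basis\<close>

text \<open>The Rayleigh quotient attains its maximum on the compact unit sphere of
  \<open>S\<close>, and a maximizer is an eigenvector.\<close>

lemma symmetric_eigenvector:
  fixes f :: "'a::euclidean_space \<Rightarrow> 'a"
  assumes lin: "linear f" and sym: "\<And>u v. f u \<bullet> v = u \<bullet> f v"
    and S: "subspace S" "f ` S \<subseteq> S" "S \<noteq> {0}"
  obtains e \<mu> where "e \<in> S" "norm e = 1" "f e = \<mu> *\<^sub>R e"
proof -
  interpret linear f by fact
  define K where "K = sphere 0 1 \<inter> S"
  have "compact K"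
    unfolding K_def using closed_subspace[OF S(1)] by (intro compact_Int_closed) auto
  moreover have "K \<noteq> {}"
  proof -
    obtain x where "x \<in> S" "x \<noteq> 0" using S subspace_0 by blast
    then have "(1 / norm x) *\<^sub>R x \<in> K"
      by (simp add: K_def subspace_scale[OF S(1)])
    then show ?thesis by blast
  qed
  moreover have "continuous_on K (\<lambda>x. f x \<bullet> x)"
    using linear_continuous_on_compose[OF continuous_on_id lin] by (rule continuous_on_inner) (rule continuous_on_id)
  ultimately obtain e where e: "e \<in> K" and max: "\<And>x. x \<in> K \<Longrightarrow> f x \<bullet> x \<le> f e \<bullet> e"
    using continuous_attains_sup[of K "\<lambda>x. f x \<bullet> x"] by blast
  define \<mu> where "\<mu> = f e \<bullet> e"
  have eS: "e \<in> S" and e1: "norm e = 1" "e \<bullet> e = 1"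
    using e by (auto simp: K_def norm_eq_1)
  define g where "g x = \<mu> * (x \<bullet> x) - f x \<bullet> x" for x
  have g: "0 \<le> g x" if "x \<in> S" for x
  proof (cases "x = 0")
    case False
    have "(1 / norm x) *\<^sub>R x \<in> K"
      using that False by (simp add: K_def subspace_scale[OF S(1)])
    from max[OF this] have "f x \<bullet> x / (norm x)\<^sup>2 \<le> \<mu>"
      by (simp add: scale \<mu>_def power2_eq_square)
    then show ?thesis
      using False by (simp add: g_def divide_le_eq power2_norm_eq_inner)
  qed (simp add: g_def)
  text \<open>The form \<open>g\<close> is nonnegative with \<open>g e = 0\<close>, so moving from \<open>e\<close> along \<open>z\<close> cannot make it negative.\<close>
  define z where "z = \<mu> *\<^sub>R e - f e"
  have zS: "z \<in> S"
    using eS S by (auto simp: z_def intro!: subspace_diff subspace_scale)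
  \<comment> \<open>As a function of \<open>t\<close>, \<open>g (e + t *\<^sub>R z)\<close> is
    quadratic with slope \<open>2 * (z \<bullet> z)\<close> at zero. This choice turns it into
    \<open>- (t\<^sup>2) * (g z + 2)\<close>, so nonnegativity forces \<open>t = 0\<close> and hence
    \<open>z = 0\<close>. The summand \<open>1\<close> keeps the denominator positive.\<close>
  define t where "t = - (z \<bullet> z) / (g z + 1)"
  have gz: "0 \<le> g z" using g[OF zS] .
  have zz: "z \<bullet> z = \<mu> * (e \<bullet> z) - f e \<bullet> z"
    by (simp add: z_def inner_diff_left)
  have fz: "f z \<bullet> e = f e \<bullet> z"
    using sym[of z e] by (simp add: inner_commute)
  have "g (e + t *\<^sub>R z) = 2 * t * (z \<bullet> z) + t\<^sup>2 * g z"
    unfolding zz unfolding g_def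
    by (simp add: add scale inner_add_left inner_add_right fz inner_commute[of z e] e1
        \<mu>_def[symmetric] power2_eq_square algebra_simps)
  moreover have "0 \<le> g (e + t *\<^sub>R z)"
    using eS zS S(1) by (intro g subspace_add subspace_scale)
  moreover have "2 * t * (z \<bullet> z) = - 2 * t\<^sup>2 * (g z + 1)"
  proof -
    have "z \<bullet> z = - t * (g z + 1)" using gz by (simp add: t_def)
    then show ?thesis by (simp add: power2_eq_square)
  qed
  ultimately have "t\<^sup>2 * (g z + 2) \<le> 0"
    by (simp add: algebra_simps)
  moreover have "0 \<le> t\<^sup>2 * (g z + 2)" using gz by simp
  ultimately have "t\<^sup>2 * (g z + 2) = 0" by linarith
  then have "z = 0"
    using gz by (auto simp: t_def)
  then show ?thesis
    using that[OF eS e1(1), of \<mu>] by (simp add: z_def)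
qed

text \<open>Induct on the dimension: split off a unit eigenvector \<open>e\<close>. By symmetry its
  orthogonal complement within \<open>S\<close> is again invariant, and it has smaller
  dimension.\<close>

lemma symmetric_eigenbasis_subspace:
  fixes f :: "'a::euclidean_space \<Rightarrow> 'a"
  assumes lin: "linear f" and sym: "\<And>u v. f u \<bullet> v = u \<bullet> f v"
  shows "subspace S \<Longrightarrow> f ` S \<subseteq> S \<Longrightarrow> \<exists>B. pairwise orthogonal B \<and> span B = S \<and>
    (\<forall>b\<in>B. norm b = 1 \<and> (\<exists>\<mu>. f b = \<mu> *\<^sub>R b))"
proof (induction "dim S" arbitrary: S rule: less_induct)
  case less
  interpret linear f by fact
  show ?case
  proof (cases "S = {0}")
    case True
    then show ?thesis by (intro exI[of _ "{}"]) auto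
  next
    case False
    obtain e \<mu> where e: "e \<in> S" "norm e = 1" "f e = \<mu> *\<^sub>R e"
      using symmetric_eigenvector[OF lin sym less.prems False] by metis
    have ee: "e \<bullet> e = 1" using e by (simp add: norm_eq_1)
    define T where "T = {x \<in> S. e \<bullet> x = 0}"
    have T: "subspace T"
      using less.prems(1) subspace_hyperplane[of e] by (auto simp: T_def subspace_def inner_add_right)
    moreover have "e \<notin> T" using ee by (simp add: T_def)
    ultimately have "dim T < dim S"
      using e(1) less.prems(1) subspace_dim_equal[of T S] by (force simp: T_def not_le)
    moreover have "f ` T \<subseteq> T"
      using less.prems(2) sym[of e] e(3) by (auto simp: T_def simp flip: sym)
    ultimately obtain B where B: "pairwise orthogonal B" "span B = T"
      "\<forall>b\<in>B. norm b = 1 \<and> (\<exists>\<mu>. f b = \<mu> *\<^sub>R b)"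
      using less.hyps[of T] T by blast
    have "pairwise orthogonal (insert e B)"
      using B(1,2) span_superset[of B]
      by (intro pairwise_orthogonal_insert) (auto simp: T_def orthogonal_def)
    moreover have "span (insert e B) = S"
    proof
      show "span (insert e B) \<subseteq> S"
        using e B(2) span_superset[of B] less.prems(1) by (intro span_minimal) (auto simp: T_def)
      show "S \<subseteq> span (insert e B)"
      proof
        fix x assume "x \<in> S"
        then have "x - (e \<bullet> x) *\<^sub>R e \<in> T"
          using e(1) ee less.prems(1)
          by (auto simp: T_def inner_diff_right intro!: subspace_diff subspace_scale)
        then show "x \<in> span (insert e B)"
          unfolding span_breakdown_eq B(2) by blast
      qed
    qed
    ultimately show ?thesis
      using B(3) e by (intro exI[of _ "insert e B"]) auto
  qed
qed

section \<open>Coordinates and functional calculus in an orthonormal basis\<close>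

locale orthonormal_basis =
  fixes B :: "'a::euclidean_space set"
  assumes orthogonal_basis: "pairwise orthogonal B"
    and norm_basis: "b \<in> B \<Longrightarrow> norm b = 1"
    and span_basis: "span B = UNIV"
begin

lemma finite_basis: "finite B"
  using orthogonal_basis norm_basis pairwise_orthogonal_imp_finite by auto

lemma inner_basis: "b \<in> B \<Longrightarrow> c \<in> B \<Longrightarrow> b \<bullet> c = (if b = c then 1 else 0)"
  using orthogonal_basis norm_basis[of b]
  by (auto simp: pairwise_def orthogonal_def norm_eq_1)

lemma expand: "(\<Sum>b\<in>B. (v \<bullet> b) *\<^sub>R b) = v"
  using orthogonal_basis norm_basis span_basis finite_basis
  by (intro orthonormal_basis_expand) auto

lemma inner_expand: "u \<bullet> v = (\<Sum>b\<in>B. (u \<bullet> b) * (v \<bullet> b))"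
  by (subst expand[of v, symmetric]) (simp add: inner_sum_right mult.commute)

lemma norm_expand: "(norm v)\<^sup>2 = (\<Sum>b\<in>B. (v \<bullet> b)\<^sup>2)"
  unfolding power2_norm_eq_inner by (subst inner_expand) (simp add: power2_eq_square)

lemma blinfun_eqI_basis:
  assumes "\<And>b. b \<in> B \<Longrightarrow> blinfun_apply A b = blinfun_apply C b"
  shows "A = C"
proof (rule blinfun_eqI)
  fix v
  have "A (\<Sum>b\<in>B. (v \<bullet> b) *\<^sub>R b) = C (\<Sum>b\<in>B. (v \<bullet> b) *\<^sub>R b)"
    by (simp add: blinfun.sum_right blinfun.scaleR_right assms)
  then show "A v = C v" by (simp add: expand)
qed

text \<open>Expanding the standard basis vectors in \<open>B\<close> and exchanging the sums leaves
  Parseval's identity in the standard basis.\<close>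

lemma op_trace_expand: "op_trace A = (\<Sum>b\<in>B. A b \<bullet> b)"
proof -
  have "op_trace A = (\<Sum>e\<in>Basis. A (\<Sum>b\<in>B. (e \<bullet> b) *\<^sub>R b) \<bullet> e)"
    by (simp add: op_trace_def expand)
  also have "\<dots> = (\<Sum>e\<in>Basis. \<Sum>b\<in>B. (A b \<bullet> e) * (b \<bullet> e))"
    unfolding blinfun.sum_right blinfun.scaleR_right inner_sum_left inner_scaleR_left
    by (simp add: inner_commute mult.commute)
  also have "\<dots> = (\<Sum>b\<in>B. \<Sum>e\<in>Basis. (A b \<bullet> e) * (b \<bullet> e))"
    by (rule sum.swap)
  also have "\<dots> = (\<Sum>b\<in>B. A b \<bullet> b)"
    by (intro sum.cong refl) (rule euclidean_inner[symmetric])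
  finally show ?thesis .
qed

text \<open>The spectral form of a symmetric operator: products, inverses and square roots become
  pointwise operations on the eigenvalues \<open>s\<close>.\<close>

definition diagonal :: "('a \<Rightarrow> real) \<Rightarrow> 'a \<Rightarrow>\<^sub>L 'a" where
  "diagonal s = (\<Sum>b\<in>B. s b *\<^sub>R outer b b)"

lemma diagonal_basis: "b \<in> B \<Longrightarrow> diagonal s b = s b *\<^sub>R b"
proof -
  assume b: "b \<in> B"
  have "diagonal s b = (\<Sum>c\<in>B. if c = b then s b *\<^sub>R b else 0)"
    unfolding diagonal_def blinfun.sum_left blinfun.scaleR_left outer_apply
    using b by (intro sum.cong) (auto simp: inner_basis)
  then show ?thesis
    using b finite_basis by simp
qed

lemma diagonal_inner_basis: "b \<in> B \<Longrightarrow> diagonal s v \<bullet> b = s b * (v \<bullet> b)"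
proof -
  assume b: "b \<in> B"
  have "diagonal s v \<bullet> b = (\<Sum>c\<in>B. if c = b then s b * (v \<bullet> b) else 0)"
    unfolding diagonal_def blinfun.sum_left blinfun.scaleR_left outer_apply inner_sum_left
    using b by (intro sum.cong) (auto simp: inner_basis inner_commute)
  then show ?thesis
    using b finite_basis by simp
qed

lemma diagonal_inner: "diagonal s u \<bullet> v = (\<Sum>b\<in>B. s b * (u \<bullet> b) * (v \<bullet> b))"
  by (subst inner_expand) (intro sum.cong, auto simp: diagonal_inner_basis)

lemma diagonal_compose: "diagonal s o\<^sub>L diagonal t = diagonal (\<lambda>b. s b * t b)"
  by (rule blinfun_eqI_basis) (simp add: diagonal_basis blinfun.scaleR_right mult.commute)

lemma diagonal_cong: "(\<And>b. b \<in> B \<Longrightarrow> s b = t b) \<Longrightarrow> diagonal s = diagonal t"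
  by (simp add: diagonal_def)

lemma diagonal_one: "diagonal (\<lambda>_. 1) = id_blinfun"
  by (rule blinfun_eqI_basis) (simp add: diagonal_basis)

lemma pos_semidef_diagonal_iff: "pos_semidef (diagonal s) \<longleftrightarrow> (\<forall>b\<in>B. 0 \<le> s b)"
proof
  assume "pos_semidef (diagonal s)"
  then show "\<forall>b\<in>B. 0 \<le> s b"
    by (metis pos_semidef_def diagonal_inner_basis inner_basis mult.right_neutral)
next
  assume "\<forall>b\<in>B. 0 \<le> s b"
  then show "pos_semidef (diagonal s)"
    unfolding pos_semidef_def
    by (auto simp: diagonal_inner inner_commute[of _ "diagonal s _"] mult_ac intro!: sum_nonneg)
qed

text \<open>Since \<open>op_inv\<close> is a definite description, exhibiting an inverse is not
  enough; uniqueness follows by inserting \<open>diagonal s o\<^sub>L D\<close> after any other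
  inverse \<open>C\<close>.\<close>

lemma op_inv_diagonal:
  assumes "\<And>b. b \<in> B \<Longrightarrow> s b \<noteq> 0"
  shows "op_inv (diagonal s) = diagonal (\<lambda>b. 1 / s b)"
proof -
  define D where "D = diagonal (\<lambda>b. 1 / s b)"
  have D: "diagonal s o\<^sub>L D = id_blinfun" "D o\<^sub>L diagonal s = id_blinfun"
    using assms by (auto simp: D_def diagonal_compose simp flip: diagonal_one intro!: diagonal_cong)
  show ?thesis
    unfolding op_inv_def D_def[symmetric]
  proof (rule the_equality)
    fix C assume C: "diagonal s o\<^sub>L C = id_blinfun \<and> C o\<^sub>L diagonal s = id_blinfun"
    show "C = D"
    proof (rule blinfun_eqI)
      fix v
      have "C v = C (diagonal s (D v))"
        using D(1) by (metis blinfun_apply_blinfun_compose id_blinfun.rep_eq id_apply)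
      then show "C v = D v"
        using C by (metis blinfun_apply_blinfun_compose id_blinfun.rep_eq id_apply)
    qed
  qed (use D in auto)
qed

lemma op_sqrt_diagonal:
  assumes s: "\<And>b. b \<in> B \<Longrightarrow> 0 \<le> s b"
  shows "op_sqrt (diagonal s) = diagonal (\<lambda>b. sqrt (s b))"
  unfolding op_sqrt_def
proof (rule the_equality)
  show "pos_semidef (diagonal (\<lambda>b. sqrt (s b))) \<and>
      diagonal (\<lambda>b. sqrt (s b)) o\<^sub>L diagonal (\<lambda>b. sqrt (s b)) = diagonal s"
    using s by (auto simp: pos_semidef_diagonal_iff diagonal_compose intro!: diagonal_cong)
next
  fix R assume R: "pos_semidef R \<and> R o\<^sub>L R = diagonal s"
  show "R = diagonal (\<lambda>b. sqrt (s b))"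
  proof (rule blinfun_eqI_basis)
    fix b assume b: "b \<in> B"
    have RR: "R (R b) = s b *\<^sub>R b"
      using R diagonal_basis[OF b, of s] by (metis blinfun_apply_blinfun_compose)
    \<comment> \<open>The root \<open>R\<close> is not assumed diagonal in \<open>B\<close>.
      Applying \<open>R + sqrt (s b)\<close> to \<open>z\<close> gives
      \<open>R (R b) - s b *\<^sub>R b = 0\<close>, and positivity of \<open>R\<close> forces
      \<open>z = 0\<close> when \<open>s b > 0\<close>. When \<open>s b = 0\<close>, the squared
      norm of \<open>R b\<close> is \<open>R (R b) \<bullet> b = 0\<close>.\<close>
    define z where "z = R b - sqrt (s b) *\<^sub>R b"
    have "z = 0"
    proof (cases "s b = 0")
      case True
      then have "R b \<bullet> R b = 0"
        using R RR unfolding pos_semidef_def by (metis inner_zero_right scaleR_zero_left)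
      then show ?thesis using True by (simp add: z_def)
    next
      case False
      have "R z + sqrt (s b) *\<^sub>R z = 0"
        using s[OF b] by (simp add: z_def blinfun.diff_right blinfun.scaleR_right RR scaleR_diff_right)
      then have "R z \<bullet> z + sqrt (s b) * (z \<bullet> z) = 0"
        by (metis inner_add_left inner_scaleR_left inner_zero_left)
      moreover have "0 \<le> R z \<bullet> z" "0 \<le> sqrt (s b) * (z \<bullet> z)"
        using R s[OF b] by (auto simp: pos_semidef_def)
      ultimately have "sqrt (s b) * (z \<bullet> z) = 0" by linarith
      then show ?thesis using False by simp
    qed
    then show "R b = diagonal (\<lambda>b. sqrt (s b)) b"
      by (simp add: z_def diagonal_basis[OF b])
  qed
qed

end

lemma symmetric_diagonalization:
  fixes A :: "'a::euclidean_space \<Rightarrow>\<^sub>L 'a"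
  assumes "\<And>u v. A u \<bullet> v = u \<bullet> A v"
  obtains B s where "orthonormal_basis B" "A = orthonormal_basis.diagonal B s"
proof -
  obtain B where B: "pairwise orthogonal B" "span B = UNIV"
    "\<forall>b\<in>B. norm b = 1 \<and> (\<exists>\<mu>. A b = \<mu> *\<^sub>R b)"
    using symmetric_eigenbasis_subspace[OF bounded_linear.linear[OF blinfun.bounded_linear_right] assms
        subspace_UNIV] by blast
  then interpret orthonormal_basis B by unfold_locales auto
  obtain s where "\<forall>b\<in>B. A b = s b *\<^sub>R b" using B(3) by metis
  then have "A = diagonal s"
    by (intro blinfun_eqI_basis) (simp add: diagonal_basis)
  then show ?thesis
    using that orthonormal_basis_axioms by blast
qed

section \<open>Second moment operators and the objective\<close>

lemma bounded_linear_blinfun_inner: "bounded_linear (\<lambda>A :: 'a::euclidean_space \<Rightarrow>\<^sub>L 'a. A u \<bullet> v)"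
  by (intro bounded_linear_compose[OF bounded_linear_inner_left] blinfun.bounded_linear_left)

lemma continuous_outer: "continuous_on UNIV (\<lambda>u :: 'a::euclidean_space. outer u u)"
  unfolding outer_def
  by (intro bounded_bilinear.continuous_on[OF bounded_bilinear_blinfun_compose] linear_continuous_on
      bounded_linear_blinfun_scaleR_left bounded_linear_blinfun_inner_right)

lemma norm_outer_le: "norm (outer u u) \<le> (norm u)\<^sup>2"
proof (rule norm_blinfun_bound)
  fix w
  have "\<bar>u \<bullet> w\<bar> * norm u \<le> norm u * norm w * norm u"
    by (intro mult_right_mono Cauchy_Schwarz_ineq2) auto
  then show "norm (outer u u w) \<le> (norm u)\<^sup>2 * norm w"
    by (simp add: outer_apply power2_eq_square mult_ac)
qed auto

text \<open>Evaluating an operator at \<open>u\<close> and pairing with \<open>v\<close> is bounded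
  linear, hence commutes with the operator-valued integral, whose existence follows from
  \<open>norm_outer_le\<close>.\<close>

lemma second_moment_inner:
  fixes X :: "'w \<Rightarrow> 'a::euclidean_space"
  assumes [measurable]: "X \<in> borel_measurable M" and int: "integrable M (\<lambda>\<omega>. (norm (X \<omega>))\<^sup>2)"
  shows "integrable M (\<lambda>\<omega>. (X \<omega> \<bullet> u) * (X \<omega> \<bullet> v))"
    and "second_moment M X u \<bullet> v = (\<integral>\<omega>. (X \<omega> \<bullet> u) * (X \<omega> \<bullet> v) \<partial>M)"
proof -
  have "(\<lambda>\<omega>. outer (X \<omega>) (X \<omega>)) \<in> borel_measurable M"
    by (rule measurable_compose[OF assms(1) borel_measurable_continuous_onI[OF continuous_outer]])
  then have o: "integrable M (\<lambda>\<omega>. outer (X \<omega>) (X \<omega>))"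
    using norm_outer_le by (intro Bochner_Integration.integrable_bound[OF int]) auto
  have eq: "outer (X \<omega>) (X \<omega>) u \<bullet> v = (X \<omega> \<bullet> u) * (X \<omega> \<bullet> v)" for \<omega>
    by (simp add: outer_apply)
  show "integrable M (\<lambda>\<omega>. (X \<omega> \<bullet> u) * (X \<omega> \<bullet> v))"
    using integrable_bounded_linear[OF bounded_linear_blinfun_inner o, of u v] by (simp add: eq)
  show "second_moment M X u \<bullet> v = (\<integral>\<omega>. (X \<omega> \<bullet> u) * (X \<omega> \<bullet> v) \<partial>M)"
    using integral_bounded_linear[OF bounded_linear_blinfun_inner o, of u v]
    by (simp add: eq second_moment_def)
qed

lemma integrable_scaleR_of_square_integrable:
  fixes X :: "'w \<Rightarrow> 'a::euclidean_space"
  assumes [measurable]: "X \<in> borel_measurable M" "Y \<in> borel_measurable M"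
    and int: "integrable M (\<lambda>\<omega>. (norm (X \<omega>))\<^sup>2)" "integrable M (\<lambda>\<omega>. (Y \<omega>)\<^sup>2)"
  shows "integrable M (\<lambda>\<omega>. Y \<omega> *\<^sub>R X \<omega>)"
proof (rule Bochner_Integration.integrable_bound)
  show "integrable M (\<lambda>\<omega>. (norm (X \<omega>))\<^sup>2 + (Y \<omega>)\<^sup>2)" using int by simp
  have "\<bar>r\<bar> * t \<le> t\<^sup>2 + r\<^sup>2" for r t :: real
    using zero_le_power2[of "\<bar>r\<bar> - t"] zero_le_power2[of r] zero_le_power2[of t]
    unfolding power2_diff power2_abs mult.assoc by linarith
  then show "AE \<omega> in M. norm (Y \<omega> *\<^sub>R X \<omega>) \<le> norm ((norm (X \<omega>))\<^sup>2 + (Y \<omega>)\<^sup>2)"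
    by (auto simp: abs_of_nonneg)
qed simp

text \<open>The objective is quadratic and \<open>opt\<close> is the normal equation at
  \<open>t\<close>, so its expansion around \<open>t\<close> has no first-order term.\<close>

lemma objective_excess:
  fixes X :: "'w \<Rightarrow> 'a::euclidean_space"
  assumes [measurable]: "X \<in> borel_measurable M" "Y \<in> borel_measurable M"
    and int: "integrable M (\<lambda>\<omega>. (norm (X \<omega>))\<^sup>2)" "integrable M (\<lambda>\<omega>. (Y \<omega>)\<^sup>2)"
    and opt: "second_moment M X t = (\<integral>\<omega>. Y \<omega> *\<^sub>R X \<omega> \<partial>M)"
  shows "objective M X Y z = objective M X Y t + second_moment M X (z - t) \<bullet> (z - t) / 2"
proof -
  note sm = second_moment_inner[OF assms(1) int(1)]
  note yx = integrable_scaleR_of_square_integrable[OF assms(1,2) int]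
  have Yint: "integrable M (\<lambda>\<omega>. Y \<omega> * (X \<omega> \<bullet> v))" for v
    using integrable_inner_left[of v, OF yx] by simp
  have cross: "(\<integral>\<omega>. Y \<omega> * (X \<omega> \<bullet> v) \<partial>M) = (\<integral>\<omega>. (X \<omega> \<bullet> t) * (X \<omega> \<bullet> v) \<partial>M)" for v
    using integral_inner_left[of v, OF yx] by (simp add: opt[symmetric] sm(2))
  have sq: "integrable M (\<lambda>\<omega>. (X \<omega> \<bullet> v - Y \<omega>)\<^sup>2)" for v
  proof -
    have "(\<lambda>\<omega>. (X \<omega> \<bullet> v - Y \<omega>)\<^sup>2) =
        (\<lambda>\<omega>. (X \<omega> \<bullet> v) * (X \<omega> \<bullet> v) - 2 * (Y \<omega> * (X \<omega> \<bullet> v)) + (Y \<omega>)\<^sup>2)"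
      by (auto simp: power2_eq_square algebra_simps)
    then show ?thesis using sm(1)[of v v] Yint[of v] int(2) by simp
  qed
  \<comment> \<open>The last summand is the first-order term; its integral vanishes by
    \<open>cross\<close>.\<close>
  have "(\<integral>\<omega>. (X \<omega> \<bullet> z - Y \<omega>)\<^sup>2 \<partial>M) =
      (\<integral>\<omega>. (X \<omega> \<bullet> t - Y \<omega>)\<^sup>2 + (X \<omega> \<bullet> (z - t)) * (X \<omega> \<bullet> (z - t))
        + 2 * ((X \<omega> \<bullet> t) * (X \<omega> \<bullet> (z - t)) - Y \<omega> * (X \<omega> \<bullet> (z - t))) \<partial>M)"
    by (simp add: power2_eq_square inner_diff_right algebra_simps)
  also have "\<dots> = (\<integral>\<omega>. (X \<omega> \<bullet> t - Y \<omega>)\<^sup>2 \<partial>M) + second_moment M X (z - t) \<bullet> (z - t)"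
    using sq[of t] sm(1)[of "z - t" "z - t"] sm(1)[of t "z - t"] Yint[of "z - t"] cross[of "z - t"]
    by (simp add: sm(2))
  finally show ?thesis by (simp add: objective_def)
qed

section \<open>Decoupling along the eigenbasis of \<Sigma> and summation of the scalar
  bounds\<close>

theorem theorem2:
  fixes M :: "'w measure"
    and x :: "nat \<Rightarrow> 'w \<Rightarrow> 'a::euclidean_space" and y :: "nat \<Rightarrow> 'w \<Rightarrow> real"
    and \<Sigma> :: "'a \<Rightarrow>\<^sub>L 'a" and \<theta>opt \<theta>0 :: 'a
    and \<tau> lam \<gamma> \<delta> :: real
    and \<theta> :: "int \<Rightarrow> 'w \<Rightarrow> 'a" and \<theta>bar :: "nat \<Rightarrow> 'w \<Rightarrow> 'a"
    and n :: nat
  assumes "prob_space M"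
    and "iid_observations M x y"
    and "\<And>n. n \<ge> 1 \<Longrightarrow> integrable M (\<lambda>\<omega>. (norm (x n \<omega>))\<^sup>2)"
    and "\<And>n. n \<ge> 1 \<Longrightarrow> integrable M (\<lambda>\<omega>. (y n \<omega>)\<^sup>2)"
    and "\<Sigma> = second_moment M (x 1)"
    and "op_invertible \<Sigma>"
    and "\<theta>opt = op_inv \<Sigma> (\<integral>\<omega>. y 1 \<omega> *\<^sub>R x 1 \<omega> \<partial>M)"
    and "\<And>n. n \<ge> 1 \<Longrightarrow> integrable M (\<lambda>\<omega>. (norm (gradient_noise M (x n) (y n) \<omega>))\<^sup>2)"
    and "\<And>n. n \<ge> 1 \<Longrightarrow> second_moment M (gradient_noise M (x n) (y n)) \<preceq>\<^sub>L \<tau>\<^sup>2 *\<^sub>R \<Sigma>"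
    and "lam \<ge> 0" and "\<gamma> > 0"
    and "\<gamma> *\<^sub>R (\<Sigma> + lam *\<^sub>R id_blinfun) \<preceq>\<^sub>L id_blinfun"
    and "\<delta> \<in> {(1 - sqrt (\<gamma> * lam)) / (1 + sqrt (\<gamma> * lam))..1}"
    and "\<And>\<omega>. \<omega> \<in> space M \<Longrightarrow> \<theta> 0 \<omega> = \<theta>0"
    and "\<And>\<omega>. \<omega> \<in> space M \<Longrightarrow> \<theta> (- 1) \<omega> = \<theta>0"
    and "\<And>n \<omega>. n \<ge> 1 \<Longrightarrow> \<omega> \<in> space M \<Longrightarrow>
      \<theta> (int n) \<omega> =
        (id_blinfun - \<gamma> *\<^sub>R \<Sigma> - (\<gamma> * lam) *\<^sub>R id_blinfun)
          (\<theta> (int n - 1) \<omega> + \<delta> *\<^sub>R (\<theta> (int n - 1) \<omega> - \<theta> (int n - 2) \<omega>))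
        + \<gamma> *\<^sub>R (y n \<omega> *\<^sub>R x n \<omega>) + (\<gamma> * lam) *\<^sub>R \<theta>0"
    and "\<And>n \<omega>. \<theta>bar n \<omega> = (1 / (real n + 1)) *\<^sub>R (\<Sum>i=0..n. \<theta> (int i) \<omega>)"
    and "n \<ge> 1"
  shows "integrable M (\<lambda>\<omega>. objective M (x 1) (y 1) (\<theta>bar n \<omega>)) \<and>
    (\<integral>\<omega>. objective M (x 1) (y 1) (\<theta>bar n \<omega>) \<partial>M) - objective M (x 1) (y 1) \<theta>opt
      \<le> 2 * (lam + 36 / (\<gamma> * (real n + 1)\<^sup>2)) *
          (norm ((op_sqrt \<Sigma> o\<^sub>L op_inv (op_sqrt (\<Sigma> + lam *\<^sub>R id_blinfun))) (\<theta>0 - \<theta>opt)))\<^sup>2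
        + 8 * \<tau>\<^sup>2 *
          op_trace ((\<Sigma> o\<^sub>L \<Sigma>) o\<^sub>L
            (op_inv (\<Sigma> + lam *\<^sub>R id_blinfun) o\<^sub>L op_inv (\<Sigma> + lam *\<^sub>R id_blinfun)))
          / (real n + 1)"
proof -
  interpret prob_space M by fact
  note indep = conjunct1[OF assms(2)[unfolded iid_observations_def]]
  note ident = conjunct2[OF assms(2)[unfolded iid_observations_def], rule_format]
  have pm: "(\<lambda>\<omega>. (x k \<omega>, y k \<omega>)) \<in> borel_measurable M" if "k \<ge> 1" for k
    using indep that by (auto simp: indep_vars_def)
  have xm: "x k \<in> borel_measurable M" and ym: "y k \<in> borel_measurable M" if "k \<ge> 1" for k
    using borel_measurable_continuous_onI[OF continuous_on_fst[OF continuous_on_id], THEN measurable_compose[OF pm[OF that]]]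
      borel_measurable_continuous_onI[OF continuous_on_snd[OF continuous_on_id], THEN measurable_compose[OF pm[OF that]]]
    by simp_all
  define m where "m = (\<integral>\<omega>. y 1 \<omega> *\<^sub>R x 1 \<omega> \<partial>M)"
  \<comment> \<open>The mean depends only on the joint law of the pair, which is the same for all
    indices.\<close>
  have m: "(\<integral>\<omega>. y k \<omega> *\<^sub>R x k \<omega> \<partial>M) = m" if k: "k \<ge> 1" for k
  proof -
    have g: "(\<lambda>p :: 'a \<times> real. snd p *\<^sub>R fst p) \<in> borel_measurable borel"
      by (intro borel_measurable_continuous_onI continuous_intros)
    show ?thesis
      using integral_distr[OF pm[OF k] g] integral_distr[OF pm[of 1] g] ident[OF k] by (simp add: m_def)
  qed
  have noise: "gradient_noise M (x k) (y k) \<omega> = y k \<omega> *\<^sub>R x k \<omega> - m" if "k \<ge> 1" for k \<omega>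
    using m[OF that] by (simp add: gradient_noise_def)
  have noise_meas: "gradient_noise M (x k) (y k) \<in> borel_measurable M" if k: "k \<ge> 1" for k
    unfolding gradient_noise_def using xm[OF k] ym[OF k] by measurable
  note sm = second_moment_inner[OF xm[OF order_refl] assms(3)[OF order_refl]]

  have "\<Sigma> u \<bullet> v = u \<bullet> \<Sigma> v" for u v
    unfolding assms(5) inner_commute[of u] sm(2) by (simp add: mult.commute)
  then obtain B s where "orthonormal_basis B" and \<Sigma>: "\<Sigma> = orthonormal_basis.diagonal B s"
    by (rule symmetric_diagonalization)
  interpret orthonormal_basis B by fact
  \<comment> \<open>A second moment has nonnegative eigenvalues and invertibility excludes zero.
    Hence \<open>s b + lam\<close> is positive even for \<open>lam = 0\<close>.\<close>
  have s: "0 < s b" if b: "b \<in> B" for b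
  proof -
    have "s b = \<Sigma> b \<bullet> b"
      using b by (simp add: \<Sigma> diagonal_inner_basis inner_basis)
    then have "0 \<le> s b"
      unfolding assms(5) sm(2) by simp
    moreover have "s b \<noteq> 0"
    proof
      assume "s b = 0"
      then have "\<Sigma> b = 0" using b by (simp add: \<Sigma> diagonal_basis)
      then have "b = 0"
        using assms(6) unfolding op_invertible_def
        by (metis blinfun_apply_blinfun_compose id_blinfun.rep_eq id_apply blinfun.zero_right)
      then show False using norm_basis[OF b] by simp
    qed
    ultimately show ?thesis by simp
  qed
  have H: "\<Sigma> + lam *\<^sub>R id_blinfun = diagonal (\<lambda>b. s b + lam)"
    by (rule blinfun_eqI_basis) (simp add: \<Sigma> diagonal_basis blinfun.add_left blinfun.scaleR_left scaleR_add_left)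
  \<comment> \<open>These normal equations serve twice: they center the error recursion and remove
    the first-order term of the objective.\<close>
  have opt: "\<Sigma> \<theta>opt = m"
  proof -
    have "\<Sigma> o\<^sub>L op_inv \<Sigma> = id_blinfun"
      using s unfolding \<Sigma> diagonal_one[symmetric]
      by (subst op_inv_diagonal) (auto simp: diagonal_compose intro!: diagonal_cong less_imp_neq[THEN not_sym])
    then show ?thesis
      unfolding assms(7) m_def by (metis blinfun_apply_blinfun_compose id_blinfun.rep_eq id_apply)
  qed
  have step_size: "\<gamma> * (s b + lam) \<le> 1" if "b \<in> B" for b
  proof -
    have "id_blinfun - \<gamma> *\<^sub>R (\<Sigma> + lam *\<^sub>R id_blinfun) = diagonal (\<lambda>b. 1 - \<gamma> * (s b + lam))"
      unfolding H by (rule blinfun_eqI_basis)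
        (simp add: diagonal_basis blinfun.diff_left blinfun.scaleR_left scaleR_diff_left)
    then show ?thesis
      using assms(12) that by (simp add: loewner_le_def pos_semidef_diagonal_iff)
  qed

  define X where "X b k \<omega> = gradient_noise M (x k) (y k) \<omega> \<bullet> b" for b k \<omega>
  define u where "u b k \<omega> = (\<theta> (int k) \<omega> - \<theta>opt) \<bullet> b" for b k \<omega>
  define U where "U b = (\<theta>0 - \<theta>opt) \<bullet> b" for b
  define N where "N = real n + 1"
  define K where "K = lam + 36 / (\<gamma> * N\<^sup>2)"
  define A where "A b \<omega> = (\<Sum>k\<le>n. u b k \<omega>) / (real n + 1)" for b \<omega>

  have coordinate: "integrable M (\<lambda>\<omega>. (A b \<omega>)\<^sup>2)"
    "expectation (\<lambda>\<omega>. (A b \<omega>)\<^sup>2) \<le> 4 * K * (U b)\<^sup>2 / (s b + lam) + 8 * (\<tau>\<^sup>2 * s b) / ((s b + lam)\<^sup>2 * N)"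
    if b: "b \<in> B" for b
  proof -
    have indep_X: "indep_vars (\<lambda>_. borel) (X b) {1..n}"
    proof -
      have "(\<lambda>p :: 'a \<times> real. (snd p *\<^sub>R fst p - m) \<bullet> b) \<in> borel_measurable borel"
        by (intro borel_measurable_continuous_onI continuous_intros)
      then have "indep_vars (\<lambda>_. borel) (\<lambda>k \<omega>. (y k \<omega> *\<^sub>R x k \<omega> - m) \<bullet> b) {1..n}"
        using indep_vars_compose2[OF indep_vars_subset[OF indep, of "{1..n}"], of "\<lambda>_ p. (snd p *\<^sub>R fst p - m) \<bullet> b" "\<lambda>_. borel"]
        by auto
      then show ?thesis
        by (rule iffD1[OF indep_vars_cong, rotated -1]) (auto simp: X_def noise fun_eq_iff)
    qed
    have sq: "integrable M (\<lambda>\<omega>. (X b k \<omega>)\<^sup>2)"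
      and var: "expectation (\<lambda>\<omega>. (X b k \<omega>)\<^sup>2) \<le> \<tau>\<^sup>2 * s b" if "k \<in> {1..n}" for k
    proof -
      from that have k: "k \<ge> 1" by simp
      note smn = second_moment_inner[OF noise_meas[OF k] assms(8)[OF k], of b b]
      show "integrable M (\<lambda>\<omega>. (X b k \<omega>)\<^sup>2)"
        using smn(1) by (simp add: X_def power2_eq_square)
      \<comment> \<open>Testing the operator inequality on the eigenvector \<open>b\<close> turns it
        into a scalar variance bound.\<close>
      have "0 \<le> (\<tau>\<^sup>2 *\<^sub>R \<Sigma> - second_moment M (gradient_noise M (x k) (y k))) b \<bullet> b"
        using assms(9)[OF k] unfolding loewner_le_def pos_semidef_def by blast
      also have "\<dots> = \<tau>\<^sup>2 * (\<Sigma> b \<bullet> b) - expectation (\<lambda>\<omega>. (X b k \<omega>)\<^sup>2)"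
        by (simp add: blinfun.diff_left blinfun.scaleR_left inner_diff_left smn(2) X_def power2_eq_square)
      finally show "expectation (\<lambda>\<omega>. (X b k \<omega>)\<^sup>2) \<le> \<tau>\<^sup>2 * s b"
        using b by (simp add: \<Sigma> diagonal_inner_basis inner_basis)
    qed
    have mean: "expectation (X b k) = 0" if "k \<in> {1..n}" for k
    proof -
      from that have k: "k \<ge> 1" by simp
      have yx: "integrable M (\<lambda>\<omega>. y k \<omega> *\<^sub>R x k \<omega>)"
        by (intro integrable_scaleR_of_square_integrable xm ym assms(3,4) k)
      have "expectation (X b k) = (\<integral>\<omega>. y k \<omega> *\<^sub>R x k \<omega> - m \<partial>M) \<bullet> b"
        unfolding X_def noise[OF k] by (rule integral_inner_left) (simp add: yx)
      also have "\<dots> = 0"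
        using yx by (simp add: m[OF k] prob_space)
      finally show ?thesis .
    qed
    \<comment> \<open>Subtracting \<open>\<theta>opt\<close> cancels the mean gradient and leaves
      the forcing \<open>\<gamma> * lam * U b\<close>. The older iterate is kept as
      \<open>\<theta> (int k - 1)\<close> so that \<open>k = 0\<close>, which refers to index -1, is
      covered.\<close>
    have rec: "u b (Suc k) \<omega> = (1 - \<gamma> * (s b + lam)) * (u b k \<omega> + \<delta> * (u b k \<omega> - (\<theta> (int k - 1) \<omega> - \<theta>opt) \<bullet> b))
        + \<gamma> * X b (Suc k) \<omega> + \<gamma> * lam * U b" if \<omega>: "\<omega> \<in> space M" for k \<omega>
    proof -
      have contract: "(id_blinfun - \<gamma> *\<^sub>R \<Sigma> - (\<gamma> * lam) *\<^sub>R id_blinfun) z \<bullet> b = (1 - \<gamma> * (s b + lam)) * (z \<bullet> b)" for z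
        using b by (simp add: blinfun.diff_left blinfun.add_left blinfun.scaleR_left inner_diff_left inner_add_left
            \<Sigma> diagonal_inner_basis algebra_simps)
      have yx: "(y (Suc k) \<omega> *\<^sub>R x (Suc k) \<omega>) \<bullet> b = X b (Suc k) \<omega> + s b * (\<theta>opt \<bullet> b)"
        using b by (simp add: X_def noise opt[symmetric] \<Sigma> diagonal_inner_basis inner_diff_left)
      have "\<theta> (int (Suc k)) \<omega> =
        (id_blinfun - \<gamma> *\<^sub>R \<Sigma> - (\<gamma> * lam) *\<^sub>R id_blinfun)
          (\<theta> (int k) \<omega> + \<delta> *\<^sub>R (\<theta> (int k) \<omega> - \<theta> (int k - 1) \<omega>))
        + \<gamma> *\<^sub>R (y (Suc k) \<omega> *\<^sub>R x (Suc k) \<omega>) + (\<gamma> * lam) *\<^sub>R \<theta>0"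
        using assms(16)[of "Suc k", OF _ \<omega>] by simp
      then have "\<theta> (int (Suc k)) \<omega> \<bullet> b =
          (1 - \<gamma> * (s b + lam)) * ((\<theta> (int k) \<omega> + \<delta> *\<^sub>R (\<theta> (int k) \<omega> - \<theta> (int k - 1) \<omega>)) \<bullet> b)
          + \<gamma> * (X b (Suc k) \<omega> + s b * (\<theta>opt \<bullet> b)) + \<gamma> * lam * (\<theta>0 \<bullet> b)"
        by (simp only: inner_add_left contract yx inner_scaleR_left[of \<gamma>] inner_scaleR_left[of "\<gamma> * lam"])
      then show ?thesis
        unfolding u_def U_def by (simp add: inner_add_left inner_diff_left algebra_simps)
    qed
    have u0: "u b 0 \<omega> = U b" if "\<omega> \<in> space M" for \<omega>
      using assms(14)[OF that] by (simp add: u_def U_def)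
    \<comment> \<open>The iterates at indices -1 and 0 agree, so the first step has no momentum
      term.\<close>
    have u1: "u b (Suc 0) \<omega> = (1 - \<gamma> * (s b + lam)) * U b + \<gamma> * X b (Suc 0) \<omega> + \<gamma> * lam * U b"
      if "\<omega> \<in> space M" for \<omega>
      using rec[OF that, of 0] assms(15)[OF that] by (simp add: u0[OF that]) (simp add: U_def)
    have u2: "u b (Suc (Suc k)) \<omega> = (1 - \<gamma> * (s b + lam)) * (u b (Suc k) \<omega> + \<delta> * (u b (Suc k) \<omega> - u b k \<omega>))
        + \<gamma> * X b (Suc (Suc k)) \<omega> + \<gamma> * lam * U b" if "\<omega> \<in> space M" for k \<omega>
      using rec[OF that, of "Suc k"] by (simp add: u_def)
    have \<delta>: "(1 - sqrt (\<gamma> * lam)) / (1 + sqrt (\<gamma> * lam)) \<le> \<delta>" "\<delta> \<le> 1"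
      using assms(13) by auto
    note bound = averaged_momentum_second_moment_le[OF s[OF b] assms(10,11) step_size[OF b] \<delta> assms(18)
        indep_X sq mean var u0 u1 u2]
    show "integrable M (\<lambda>\<omega>. (A b \<omega>)\<^sup>2)"
      "expectation (\<lambda>\<omega>. (A b \<omega>)\<^sup>2) \<le> 4 * K * (U b)\<^sup>2 / (s b + lam) + 8 * (\<tau>\<^sup>2 * s b) / ((s b + lam)\<^sup>2 * N)"
      using bound unfolding A_def K_def N_def by blast+
  qed

  have "(\<theta>bar n \<omega> - \<theta>opt) \<bullet> b = A b \<omega>" for b \<omega>
    unfolding A_def u_def assms(17)
    by (simp add: inner_diff_left inner_sum_left sum_subtractf atLeast0AtMost field_simps)
  then have excess: "objective M (x 1) (y 1) (\<theta>bar n \<omega>) =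
      objective M (x 1) (y 1) \<theta>opt + (\<Sum>b\<in>B. s b * (A b \<omega>)\<^sup>2) / 2" for \<omega>
    using objective_excess[OF xm[OF order_refl] ym[OF order_refl] assms(3)[OF order_refl]
        assms(4)[OF order_refl] opt[unfolded m_def assms(5)], of "\<theta>bar n \<omega>"]
    unfolding assms(5)[symmetric] unfolding \<Sigma> diagonal_inner by (simp only: power2_eq_square mult.assoc)
  \<comment> \<open>A Bochner integral defaults to zero without integrability, so this gives the
    expectation its intended meaning.\<close>
  have integrable: "integrable M (\<lambda>\<omega>. objective M (x 1) (y 1) (\<theta>bar n \<omega>))"
    unfolding excess using coordinate(1) by simp
  have "(\<integral>\<omega>. objective M (x 1) (y 1) (\<theta>bar n \<omega>) \<partial>M) - objective M (x 1) (y 1) \<theta>opt =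
      (\<Sum>b\<in>B. s b * expectation (\<lambda>\<omega>. (A b \<omega>)\<^sup>2)) / 2"
    unfolding excess using coordinate(1) by (simp add: prob_space)
  also have "\<dots> \<le> (\<Sum>b\<in>B. s b * (4 * K * (U b)\<^sup>2 / (s b + lam) + 8 * (\<tau>\<^sup>2 * s b) / ((s b + lam)\<^sup>2 * N))) / 2"
    using coordinate(2) s by (intro divide_right_mono sum_mono mult_left_mono) (auto intro: less_imp_le)
  also have "\<dots> = 2 * K * (\<Sum>b\<in>B. s b / (s b + lam) * (U b)\<^sup>2)
      + 4 * \<tau>\<^sup>2 * (\<Sum>b\<in>B. (s b)\<^sup>2 / (s b + lam)\<^sup>2) / N"
  proof -
    have "r * (4 * K * v / h + 8 * (\<tau>\<^sup>2 * r) / (h\<^sup>2 * N)) / 2 = 2 * K * (r / h * v) + 4 * \<tau>\<^sup>2 * (r\<^sup>2 / h\<^sup>2) / N"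
      if "h > 0" for r v h
      using that by (simp add: N_def field_simps power2_eq_square)
    then show ?thesis
      unfolding sum_distrib_left sum_divide_distrib sum.distrib[symmetric]
      using s assms(10) by (intro sum.cong refl) (simp add: add_pos_nonneg)
  qed
  \<comment> \<open>The coordinate bounds yield the variance constant \<open>4\<close>, which is
    relaxed here to the stated \<open>8\<close>.\<close>
  also have "\<dots> \<le> 2 * K * (\<Sum>b\<in>B. s b / (s b + lam) * (U b)\<^sup>2)
      + 8 * \<tau>\<^sup>2 * (\<Sum>b\<in>B. (s b)\<^sup>2 / (s b + lam)\<^sup>2) / N"
    by (intro add_left_mono divide_right_mono mult_right_mono sum_nonneg) (auto simp: N_def)
  \<comment> \<open>The composed operator has eigenvalues
    \<open>sqrt (s b) / sqrt (s b + lam)\<close>, so this is Parseval's identity for its value at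
    \<open>\<theta>0 - \<theta>opt\<close>.\<close>
  also have "(\<Sum>b\<in>B. s b / (s b + lam) * (U b)\<^sup>2) =
      (norm ((op_sqrt \<Sigma> o\<^sub>L op_inv (op_sqrt (\<Sigma> + lam *\<^sub>R id_blinfun))) (\<theta>0 - \<theta>opt)))\<^sup>2"
  proof -
    have h: "0 < s b + lam" if "b \<in> B" for b using s[OF that] assms(10) by simp
    have "op_inv (op_sqrt (diagonal (\<lambda>b. s b + lam))) = diagonal (\<lambda>b. 1 / sqrt (s b + lam))"
      using h by (subst op_sqrt_diagonal, force intro: less_imp_le, intro op_inv_diagonal) force
    moreover have "op_sqrt \<Sigma> = diagonal (\<lambda>b. sqrt (s b))"
      unfolding \<Sigma> using s by (intro op_sqrt_diagonal) (auto intro: less_imp_le)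
    ultimately show ?thesis
      unfolding H norm_expand diagonal_compose
      using s h by (intro sum.cong refl)
        (simp add: diagonal_compose diagonal_inner_basis U_def power_mult_distrib power_divide less_imp_le)
  qed
  \<comment> \<open>Evaluated in the eigenbasis, the trace is the sum of the eigenvalues of the
    product.\<close>
  also have "(\<Sum>b\<in>B. (s b)\<^sup>2 / (s b + lam)\<^sup>2) = op_trace ((\<Sigma> o\<^sub>L \<Sigma>) o\<^sub>L
      (op_inv (\<Sigma> + lam *\<^sub>R id_blinfun) o\<^sub>L op_inv (\<Sigma> + lam *\<^sub>R id_blinfun)))"
  proof -
    have "op_inv (diagonal (\<lambda>b. s b + lam)) = diagonal (\<lambda>b. 1 / (s b + lam))"
      using s assms(10) by (intro op_inv_diagonal) force
    then show ?thesis
      unfolding H by (simp add: op_trace_expand \<Sigma> diagonal_compose diagonal_inner_basis inner_basis power2_eq_square)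
  qed
  finally show ?thesis
    using integrable unfolding K_def N_def by blast
qed

end
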